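(* Let $\mathcal{I}$ be a nonempty finite index set, let $\lambda_i>0$ for $i\in\mathcal{I}$, and let $\sigma_\epsilon^2\ge 0$, $P_f\ge 0$, $P_{max}>0$ and $C_I>0$ be real numbers. Consider the optimization problem in the variables $(P_i)_{i\in\mathcal{I}}$ $$\min \sum_{i\in\mathcal{I}} P_i\quad\text{s.t.}\quad \sum_{i\in\mathcal{I}}\log\left(1+\frac{P_i\lambda_i}{1+\sigma_\epsilon^2P_f}\right)\ge C_I,\qquad 0\le P_i\le P_{max},\ i\in\mathcal{I}.$$ Set $\theta_i=(1+\sigma_\epsilon^2P_f)/\lambda_i$ for $i\in\mathcal{I}$. If the problem is feasible (i.e. $\sum_{i\in\mathcal{I}}\log(1+P_{max}/\theta_i)\ge C_I$), then its solution $(P_i^* )_{i\in\mathcal{I}}$ is given by $$P_i^*=\begin{cases}0, & \nu<\theta_i,\\ \nu-\theta_i, & \theta_i\le\nu\le\theta_i+P_{max},\\ P_{max}, & \text{otherwise},\end{cases}$$ where the Lagrange multiplier $\nu$ (of the first constraint) is derived from $$\nu=\rho^{1/|\mathcal{I}_1|},\qquad \rho=\frac{2^{C_I}\prod_{i\in\mathcal{I}_1}\theta_i}{\prod_{i\in\mathcal{I}_2}(1+P_{max}/\theta_i)},$$ and the sets $\mathcal{I}_1$ and $\mathcal{I}_2$ are defined as $\mathcal{I}_1=\{i\in\mathcal{I}:0<P_i^*<P_{max}\}$ and $\mathcal{I}_2=\{i\in\mathcal{I}:P_i^*=P_{max}\}$.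
   Context: $\log$ denotes the logarithm to base 2, and $|\mathcal{I}_1|$ is the cardinality of $\mathcal{I}_1$. Empty products equal 1. The multiplier $\nu$ is normalized so that the constant factor $1/\ln 2$ coming from the derivative of $\log$ is absorbed into it: the stationarity condition reads $1-\nu/(\theta_i+P_i)-\mu_i^L+\mu_i^U=0$ for each $i\in\mathcal{I}$, where $\mu_i^L,\mu_i^U\ge 0$ are the multipliers of $P_i\ge0$ and $P_i\le P_{max}$.
   Formalization: When I_1 is empty (e.g. one index with θ=1, P_max=1, C_I=1) the exponent 1/|I_1| is undefined; there the equation ν=ρ^{1/|I_1|} is read in its cleared form ν^{|I_1|}=ρ, i.e. ρ=1. For nonempty I_1 it is stated literally. *)

theory Defs
  imports Complex_Main
begin

definition feasible ::
  "'i set \<Rightarrow> ('i \<Rightarrow> real) \<Rightarrow> real \<Rightarrow> real \<Rightarrow> real \<Rightarrow> real \<Rightarrow> ('i \<Rightarrow> real) \<Rightarrow> bool" where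
  "feasible I lam sig2 Pf Pmax C P \<longleftrightarrow>
     (\<Sum>i\<in>I. log 2 (1 + P i * lam i / (1 + sig2 * Pf))) \<ge> C \<and>
     (\<forall>i\<in>I. 0 \<le> P i \<and> P i \<le> Pmax)"

text \<open>Only the values of an allocation on the index set \<open>I\<close> matter; solutions are therefore
  unique only up to their values outside \<open>I\<close>.\<close>

definition solution ::
  "'i set \<Rightarrow> ('i \<Rightarrow> real) \<Rightarrow> real \<Rightarrow> real \<Rightarrow> real \<Rightarrow> real \<Rightarrow> ('i \<Rightarrow> real) \<Rightarrow> bool" where
  "solution I lam sig2 Pf Pmax C P \<longleftrightarrow>
     is_arg_min (\<lambda>P. \<Sum>i\<in>I. P i) (feasible I lam sig2 Pf Pmax C) P"

definition theta :: "('i \<Rightarrow> real) \<Rightarrow> real \<Rightarrow> real \<Rightarrow> 'i \<Rightarrow> real" where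
  "theta lam sig2 Pf i = (1 + sig2 * Pf) / lam i"

text \<open>The Karush-Kuhn-Tucker conditions at \<open>P\<close>, apart from primal feasibility. The multiplier
  \<open>\<nu>\<close> of the rate constraint is scaled so as to absorb the factor \<open>1 / ln 2\<close> from the derivative
  of \<open>log 2\<close>; \<open>\<mu>L\<close> and \<open>\<mu>U\<close> belong to \<open>0 \<le> P i\<close> and \<open>P i \<le> Pmax\<close>.\<close>

definition lagrange_multiplier ::
  "'i set \<Rightarrow> ('i \<Rightarrow> real) \<Rightarrow> real \<Rightarrow> real \<Rightarrow> real \<Rightarrow> real \<Rightarrow> ('i \<Rightarrow> real) \<Rightarrow> real \<Rightarrow> bool" where
  "lagrange_multiplier I lam sig2 Pf Pmax C P \<nu> \<longleftrightarrow>
     \<nu> \<ge> 0 \<and>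
     \<nu> * ((\<Sum>i\<in>I. log 2 (1 + P i * lam i / (1 + sig2 * Pf))) - C) = 0 \<and>
     (\<exists>\<mu>L \<mu>U. \<forall>i\<in>I.
        \<mu>L i \<ge> 0 \<and> \<mu>U i \<ge> 0 \<and>
        \<mu>L i * P i = 0 \<and> \<mu>U i * (Pmax - P i) = 0 \<and>
        1 - \<nu> / (theta lam sig2 Pf i + P i) - \<mu>L i + \<mu>U i = 0)"

definition allocation :: "('i \<Rightarrow> real) \<Rightarrow> real \<Rightarrow> real \<Rightarrow> 'i \<Rightarrow> real" where
  "allocation \<theta> Pmax \<nu> i =
     (if \<nu> < \<theta> i then 0
      else if \<theta> i \<le> \<nu> \<and> \<nu> \<le> \<theta> i + Pmax then \<nu> - \<theta> i
      else Pmax)"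

definition I1 :: "'i set \<Rightarrow> real \<Rightarrow> ('i \<Rightarrow> real) \<Rightarrow> 'i set" where
  "I1 I Pmax P = {i \<in> I. 0 < P i \<and> P i < Pmax}"

definition I2 :: "'i set \<Rightarrow> real \<Rightarrow> ('i \<Rightarrow> real) \<Rightarrow> 'i set" where
  "I2 I Pmax P = {i \<in> I. P i = Pmax}"

definition rho :: "'i set \<Rightarrow> ('i \<Rightarrow> real) \<Rightarrow> real \<Rightarrow> real \<Rightarrow> ('i \<Rightarrow> real) \<Rightarrow> real" where
  "rho I \<theta> Pmax C P =
     2 powr C * (\<Prod>i\<in>I1 I Pmax P. \<theta> i) / (\<Prod>i\<in>I2 I Pmax P. 1 + Pmax / \<theta> i)"

text \<open>The equation \<open>\<nu> = \<rho>\<^bsup>1/|I1|\<^esup>\<close>. For empty \<open>I1\<close> the exponent is meaningless (and Isabelle's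
  convention \<open>1 / 0 = 0\<close> would wrongly force \<open>\<nu> = 1\<close>), so the equation is read in its cleared
  form \<open>\<nu>\<^bsup>|I1|\<^esup> = \<rho>\<close>, which then says \<open>\<rho> = 1\<close>.\<close>

definition multiplier_equation ::
  "'i set \<Rightarrow> ('i \<Rightarrow> real) \<Rightarrow> real \<Rightarrow> real \<Rightarrow> ('i \<Rightarrow> real) \<Rightarrow> real \<Rightarrow> bool" where
  "multiplier_equation I \<theta> Pmax C P \<nu> \<longleftrightarrow>
     (if I1 I Pmax P = {} then rho I \<theta> Pmax C P = 1
      else \<nu> = rho I \<theta> Pmax C P powr (1 / real (card (I1 I Pmax P))))"

end

theory Submission
  imports Defs
begin

text \<open>For \<open>\<nu> > 0\<close> the Lagrangian separates into the scalar functions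
  \<open>x - \<nu> ln (1 + x / \<theta>\<^sub>i)\<close>. Each is strictly convex, so the Karush-Kuhn-Tucker conditions
  at \<open>P\<close> make \<open>P\<close> its unique minimiser on the box, and this minimiser is the water-filling
  allocation. Since \<open>C > 0\<close>, the multiplier \<open>\<nu>\<close> cannot vanish, so the rate constraint is
  active, and exponentiating it gives the equation for \<open>\<nu>\<close>. A suitable \<open>\<nu>\<close> exists by the
  intermediate value theorem, because the rate of the allocation is continuous in \<open>\<nu>\<close>.\<close>

section \<open>Tangent bound for the logarithm and the KKT conditions in one variable\<close>

text \<open>Strict concavity: the graph of \<open>ln (1 + x / t)\<close> lies below its tangent at
  \<open>p\<close>, of slope \<open>1 / (t + p)\<close>. This is \<open>ln y < y - 1\<close> for
  \<open>y = (t + q) / (t + p)\<close>, which differs from 1.\<close>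

lemma ln_add_diff_less:
  fixes t p q :: real
  assumes "t > 0" "p \<ge> 0" "q \<ge> 0" "p \<noteq> q"
  shows "ln (1 + q / t) - ln (1 + p / t) < (q - p) / (t + p)"
proof -
  have "ln (1 + q / t) - ln (1 + p / t) = ln ((t + q) / (t + p))"
  proof -
    have "1 + q / t = (t + q) / t" "1 + p / t = (t + p) / t"
      using assms by (simp_all add: field_simps)
    then show ?thesis using assms by (simp add: ln_div)
  qed
  also have "\<dots> < (t + q) / (t + p) - 1"
  proof -
    have "(t + q) / (t + p) > 0" "(t + q) / (t + p) \<noteq> 1"
      using assms by simp_all
    then show ?thesis
      using ln_le_minus_one ln_eq_minus_one by (metis order_less_le)
  qed
  also have "\<dots> = (q - p) / (t + p)"
    using assms by (simp add: field_simps)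
  finally show ?thesis .
qed

text \<open>Without the case split, bounds on the power and continuity in \<open>\<nu>\<close>
  follow from \<open>max\<close> and \<open>min\<close>.\<close>

lemma allocation_eq_clamp:
  assumes "Pmax > 0"
  shows "allocation \<theta> Pmax \<nu> i = max 0 (min Pmax (\<nu> - \<theta> i))"
  using assms by (auto simp: allocation_def)

text \<open>Sorting by the power instead of by \<open>\<nu>\<close> matches complementary slackness
  and the sets \<open>I1\<close> and \<open>I2\<close>. The endpoints
  \<open>\<nu> = \<theta> i\<close> and \<open>\<nu> = \<theta> i + Pmax\<close> thereby join the
  outer cases.\<close>

lemma allocation_cases:
  assumes "Pmax > 0" "P i = allocation \<theta> Pmax \<nu> i"
  obtains "P i = 0" "\<nu> \<le> \<theta> i"
  | "0 < P i" "P i < Pmax" "\<nu> = \<theta> i + P i"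
  | "P i = Pmax" "\<theta> i + Pmax \<le> \<nu>"
  using assms unfolding allocation_eq_clamp[OF assms(1)] max_def min_def
  by (smt (verit))

text \<open>Since \<open>0 < Pmax\<close>, complementary slackness makes at least one multiplier
  vanish. The sign of the other one then puts \<open>\<nu>\<close> on the correct side of the
  threshold.\<close>

lemma allocation_if_kkt:
  fixes l u :: real
  assumes "\<theta> i > 0" "Pmax > 0" "0 \<le> p" "p \<le> Pmax" "l \<ge> 0" "u \<ge> 0"
    and "l * p = 0" "u * (Pmax - p) = 0" "1 - \<nu> / (\<theta> i + p) - l + u = 0"
  shows "p = allocation \<theta> Pmax \<nu> i"
proof -
  have nu: "\<nu> = (\<theta> i + p) * (1 - l + u)"
    using assms by (simp add: field_simps)
  consider "p = 0" "u = 0" | "p = Pmax" "l = 0" | "0 < p" "p < Pmax" "l = 0" "u = 0"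
    using assms by fastforce
  then show ?thesis
  proof cases
    case 1
    then have "\<nu> = \<theta> i - l * \<theta> i" using nu by (simp add: algebra_simps)
    moreover have "0 \<le> l * \<theta> i" using assms(1,5) by simp
    ultimately have "\<nu> \<le> \<theta> i" by linarith
    then show ?thesis using 1 assms by (simp add: allocation_eq_clamp)
  next
    case 2
    then have "\<nu> = \<theta> i + Pmax + u * (\<theta> i + Pmax)" using nu by (simp add: algebra_simps)
    moreover have "0 \<le> u * (\<theta> i + Pmax)" using assms(1,2,6) by simp
    ultimately have "\<theta> i + Pmax \<le> \<nu>" by linarith
    then show ?thesis using 2 assms by (simp add: allocation_eq_clamp)
  next
    case 3
    then show ?thesis using nu assms by (simp add: allocation_eq_clamp)
  qed
qed

text \<open>At an active bound the witness is the value that stationarity forces once the other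
  multiplier is zero; its sign is the inequality on \<open>\<nu>\<close> in that case.\<close>

lemma kkt_if_allocation:
  assumes "\<theta> i > 0" "Pmax > 0" "P i = allocation \<theta> Pmax \<nu> i"
  shows "\<exists>l u. l \<ge> 0 \<and> u \<ge> 0 \<and> l * P i = 0 \<and> u * (Pmax - P i) = 0 \<and>
           1 - \<nu> / (\<theta> i + P i) - l + u = 0"
  using assms(2,3)
proof (cases rule: allocation_cases)
  case 1
  with assms show ?thesis
    by (intro exI[of _ "1 - \<nu> / \<theta> i"] exI[of _ 0]) simp
next
  case 2
  with assms show ?thesis
    by (intro exI[of _ 0]) simp
next
  case 3
  with assms show ?thesis
    by (intro exI[of _ 0] exI[of _ "\<nu> / (\<theta> i + Pmax) - 1"]) (simp add: field_simps)
qed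

text \<open>The derivative of the scalar Lagrangian at \<open>P i\<close> is \<open>l - u\<close>,
  and it does not point downhill towards any \<open>q\<close> in the box. The tangent bound, scaled
  by \<open>\<nu> > 0\<close>, makes the comparison strict.\<close>

lemma lagrangian_term_strict:
  assumes "\<theta> i > 0" "Pmax > 0" "\<nu> > 0" "P i = allocation \<theta> Pmax \<nu> i"
    and "0 \<le> q" "q \<le> Pmax" "q \<noteq> P i"
  shows "P i - \<nu> * ln (1 + P i / \<theta> i) < q - \<nu> * ln (1 + q / \<theta> i)"
proof -
  have P0: "P i \<ge> 0"
    using assms by (simp add: allocation_eq_clamp)
  obtain l u where lu: "l \<ge> 0" "u \<ge> 0" "l * P i = 0" "u * (Pmax - P i) = 0"
    "1 - \<nu> / (\<theta> i + P i) - l + u = 0"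
    using kkt_if_allocation[of \<theta> i Pmax P \<nu>] assms(1,2,4) by blast
  have "q - P i - \<nu> * ((q - P i) / (\<theta> i + P i)) = (1 - \<nu> / (\<theta> i + P i)) * (q - P i)"
    by (simp add: algebra_simps)
  also have "\<dots> = (l - u) * (q - P i)"
    using lu(5) by simp
  \<comment> \<open>Complementary slackness replaces \<open>l * P i\<close> by 0 and
    \<open>u * P i\<close> by \<open>u * Pmax\<close>.\<close>
  also have "\<dots> = l * q + u * (Pmax - q)"
    using lu(3,4) by algebra
  also have "\<dots> \<ge> 0"
    using lu assms by simp
  finally have "\<nu> * ((q - P i) / (\<theta> i + P i)) \<le> q - P i" by simp
  moreover have "\<nu> * (ln (1 + q / \<theta> i) - ln (1 + P i / \<theta> i)) < \<nu> * ((q - P i) / (\<theta> i + P i))"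
    using ln_add_diff_less[of "\<theta> i" "P i" q] assms(1,3,5,7) P0
    by (intro mult_strict_left_mono) auto
  ultimately show ?thesis by (simp add: algebra_simps)
qed

text \<open>Summing the scalar comparisons, with strictness at \<open>j\<close>, bounds the
  Lagrangian. As the rate of \<open>Q\<close> is at least that of \<open>P\<close>, the rate terms
  only favour \<open>Q\<close>, so the gap must come from the powers.\<close>

lemma allocation_strict_minimum:
  fixes \<theta> P Q :: "'i \<Rightarrow> real"
  assumes "finite I" and \<theta>: "\<And>i. i \<in> I \<Longrightarrow> \<theta> i > 0" and "Pmax > 0" "\<nu> > 0"
    and P: "\<And>i. i \<in> I \<Longrightarrow> P i = allocation \<theta> Pmax \<nu> i"
    and rate: "(\<Sum>i\<in>I. log 2 (1 + P i / \<theta> i)) \<le> (\<Sum>i\<in>I. log 2 (1 + Q i / \<theta> i))"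
    and Q: "\<And>i. i \<in> I \<Longrightarrow> 0 \<le> Q i \<and> Q i \<le> Pmax"
    and j: "j \<in> I" "Q j \<noteq> P j"
  shows "(\<Sum>i\<in>I. P i) < (\<Sum>i\<in>I. Q i)"
proof -
  have "(\<Sum>i\<in>I. P i - \<nu> * ln (1 + P i / \<theta> i)) < (\<Sum>i\<in>I. Q i - \<nu> * ln (1 + Q i / \<theta> i))"
  proof (rule sum_strict_mono_ex1[OF assms(1)])
    show "\<forall>i\<in>I. P i - \<nu> * ln (1 + P i / \<theta> i) \<le> Q i - \<nu> * ln (1 + Q i / \<theta> i)"
    proof
      fix i assume "i \<in> I"
      then show "P i - \<nu> * ln (1 + P i / \<theta> i) \<le> Q i - \<nu> * ln (1 + Q i / \<theta> i)"
        using lagrangian_term_strict[of \<theta> i Pmax \<nu> P "Q i"] \<theta> P Q assms(3,4)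
        by (cases "Q i = P i") (auto intro: less_imp_le)
    qed
    show "\<exists>i\<in>I. P i - \<nu> * ln (1 + P i / \<theta> i) < Q i - \<nu> * ln (1 + Q i / \<theta> i)"
      using lagrangian_term_strict[of \<theta> j Pmax \<nu> P "Q j"] \<theta> P Q assms(3,4) j by blast
  qed
  moreover have "(\<Sum>i\<in>I. ln (1 + P i / \<theta> i)) \<le> (\<Sum>i\<in>I. ln (1 + Q i / \<theta> i))"
    using rate by (simp add: log_def flip: sum_divide_distrib) (simp add: divide_le_cancel)
  then have "\<nu> * (\<Sum>i\<in>I. ln (1 + P i / \<theta> i)) \<le> \<nu> * (\<Sum>i\<in>I. ln (1 + Q i / \<theta> i))"
    using assms(4) by simp
  ultimately show ?thesis
    by (simp add: sum_subtractf flip: sum_distrib_left)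
qed

section \<open>The active rate constraint as an equation for the multiplier\<close>

text \<open>Indices with zero power contribute the factor 1, and on \<open>I1\<close> the factor is
  \<open>\<nu> / \<theta> i\<close> because \<open>\<nu> = \<theta> i + P i\<close> there.\<close>

lemma prod_allocation:
  fixes \<theta> P :: "'i \<Rightarrow> real"
  assumes "finite I" and \<theta>: "\<And>i. i \<in> I \<Longrightarrow> \<theta> i > 0" and "Pmax > 0"
    and P: "\<And>i. i \<in> I \<Longrightarrow> P i = allocation \<theta> Pmax \<nu> i"
  shows "(\<Prod>i\<in>I. 1 + P i / \<theta> i) =
    \<nu> ^ card (I1 I Pmax P) / (\<Prod>i\<in>I1 I Pmax P. \<theta> i) * (\<Prod>i\<in>I2 I Pmax P. 1 + Pmax / \<theta> i)"
proof -
  let ?A = "I1 I Pmax P" and ?B = "I2 I Pmax P"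
  have fin: "finite ?A" "finite ?B"
    using assms(1) by (auto simp: I1_def I2_def)
  have "(\<Prod>i\<in>I. 1 + P i / \<theta> i) = (\<Prod>i\<in>?A \<union> ?B. 1 + P i / \<theta> i)"
  proof (rule prod.mono_neutral_right[OF assms(1)])
    show "?A \<union> ?B \<subseteq> I" by (auto simp: I1_def I2_def)
    show "\<forall>i\<in>I - (?A \<union> ?B). 1 + P i / \<theta> i = 1"
    proof
      fix i assume i: "i \<in> I - (?A \<union> ?B)"
      then have "P i = allocation \<theta> Pmax \<nu> i" using P by blast
      with assms(3) show "1 + P i / \<theta> i = 1"
        using i by (cases rule: allocation_cases) (auto simp: I1_def I2_def)
    qed
  qed
  also have "\<dots> = (\<Prod>i\<in>?A. 1 + P i / \<theta> i) * (\<Prod>i\<in>?B. 1 + P i / \<theta> i)"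
    by (rule prod.union_disjoint[OF fin]) (auto simp: I1_def I2_def)
  also have "(\<Prod>i\<in>?A. 1 + P i / \<theta> i) = (\<Prod>i\<in>?A. \<nu> / \<theta> i)"
  proof (rule prod.cong[OF refl])
    fix i assume i: "i \<in> ?A"
    then have "i \<in> I" and a: "P i = allocation \<theta> Pmax \<nu> i" using P by (auto simp: I1_def)
    from assms(3) a have "\<nu> = \<theta> i + P i"
      using i by (cases rule: allocation_cases) (auto simp: I1_def)
    then show "1 + P i / \<theta> i = \<nu> / \<theta> i"
      using \<theta>[OF \<open>i \<in> I\<close>] by (simp add: field_simps)
  qed
  also have "\<dots> = \<nu> ^ card ?A / (\<Prod>i\<in>?A. \<theta> i)"
    by (simp add: prod_dividef)
  also have "(\<Prod>i\<in>?B. 1 + P i / \<theta> i) = (\<Prod>i\<in>?B. 1 + Pmax / \<theta> i)"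
    by (rule prod.cong) (auto simp: I2_def)
  finally show ?thesis .
qed

text \<open>Exponentiation turns the rate into the product above, so an active constraint means that
  \<open>\<nu>\<close> to the power \<open>|I1|\<close> is \<open>rho\<close>; what remains is
  taking the root.\<close>

lemma multiplier_equation_iff_rate:
  fixes \<theta> P :: "'i \<Rightarrow> real"
  assumes "finite I" and \<theta>: "\<And>i. i \<in> I \<Longrightarrow> \<theta> i > 0" and "Pmax > 0"
    and P: "\<And>i. i \<in> I \<Longrightarrow> P i = allocation \<theta> Pmax \<nu> i"
  shows "multiplier_equation I \<theta> Pmax C P \<nu> \<longleftrightarrow> (\<Sum>i\<in>I. log 2 (1 + P i / \<theta> i)) = C"
proof -
  let ?A = "I1 I Pmax P" and ?B = "I2 I Pmax P"
  let ?\<rho> = "rho I \<theta> Pmax C P"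
  have P0: "P i \<ge> 0" if "i \<in> I" for i
    using P[OF that] assms(3) by (simp add: allocation_eq_clamp)
  have pos: "1 + P i / \<theta> i > 0" if "i \<in> I" for i
    using P0[OF that] \<theta>[OF that] by (simp add: add_pos_nonneg)
  have A: "(\<Prod>i\<in>?A. \<theta> i) > 0"
    by (rule prod_pos) (auto simp: I1_def \<theta>)
  have B: "(\<Prod>i\<in>?B. 1 + Pmax / \<theta> i) > 0"
    by (rule prod_pos) (use assms(3) \<theta> in \<open>auto simp: I2_def intro!: add_pos_pos\<close>)
  have rho_pos: "?\<rho> > 0"
    using A B by (simp add: rho_def)
  have "(\<Sum>i\<in>I. log 2 (1 + P i / \<theta> i)) = log 2 (\<Prod>i\<in>I. 1 + P i / \<theta> i)"
    using ln_prod[of I "\<lambda>i. 1 + P i / \<theta> i", OF assms(1) less_imp_neq[symmetric, OF pos]]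
    by (simp add: log_def flip: sum_divide_distrib)
  also have "\<dots> = C \<longleftrightarrow> (\<Prod>i\<in>I. 1 + P i / \<theta> i) = 2 powr C"
    using prod_pos[of I "\<lambda>i. 1 + P i / \<theta> i"] pos by (auto simp: powr_log_cancel)
  also have "\<dots> \<longleftrightarrow> \<nu> ^ card ?A = ?\<rho>"
  proof -
    have "x / a * b = c \<longleftrightarrow> x = c * a / b" if "a > 0" "b > 0" for a b c x :: real
      using that by (auto simp: field_simps)
    then show ?thesis
      using prod_allocation[of I \<theta> Pmax P \<nu>] assms A B by (simp only: rho_def)
  qed
  also have "\<dots> \<longleftrightarrow> multiplier_equation I \<theta> Pmax C P \<nu>"
  proof (cases "?A = {}")
    case True
    then show ?thesis by (auto simp: multiplier_equation_def)
  next
    case False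
    have "finite ?A" using assms(1) by (simp add: I1_def)
    with False have n: "card ?A > 0" by (simp add: card_gt_0_iff)
    \<comment> \<open>Any index in \<open>I1\<close> shows
      \<open>\<nu> = \<theta> i + P i > 0\<close>, which makes the root unambiguous.\<close>
    obtain i where i: "i \<in> ?A" using False by blast
    then have "i \<in> I" and a: "P i = allocation \<theta> Pmax \<nu> i" using P by (auto simp: I1_def)
    from assms(3) a have "\<nu> = \<theta> i + P i"
      using i by (cases rule: allocation_cases) (auto simp: I1_def)
    then have nu: "\<nu> > 0" using \<theta> P0 \<open>i \<in> I\<close> by (simp add: add_pos_nonneg)
    have "\<nu> ^ card ?A = ?\<rho> \<longleftrightarrow> \<nu> = ?\<rho> powr (1 / real (card ?A))"
    proof
      assume "\<nu> ^ card ?A = ?\<rho>"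
      then have "?\<rho> = \<nu> powr real (card ?A)" using nu by (simp add: powr_realpow)
      then show "\<nu> = ?\<rho> powr (1 / real (card ?A))" using nu n by (simp add: powr_powr)
    next
      assume *: "\<nu> = ?\<rho> powr (1 / real (card ?A))"
      have "\<nu> ^ card ?A = \<nu> powr real (card ?A)" using nu by (simp add: powr_realpow)
      also have "\<dots> = ?\<rho>" unfolding * using rho_pos n by (simp add: powr_powr)
      finally show "\<nu> ^ card ?A = ?\<rho>" .
    qed
    then show ?thesis using False by (simp add: multiplier_equation_def)
  qed
  finally show ?thesis by blast
qed

section \<open>Existence of a multiplier that meets the rate exactly\<close>

lemma ex_allocation_with_rate:
  fixes \<theta> :: "'i \<Rightarrow> real"
  assumes "finite I" and \<theta>: "\<And>i. i \<in> I \<Longrightarrow> \<theta> i > 0" and "Pmax > 0" "C \<ge> 0"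
    and max: "(\<Sum>i\<in>I. log 2 (1 + Pmax / \<theta> i)) \<ge> C"
  shows "\<exists>\<nu>. (\<Sum>i\<in>I. log 2 (1 + allocation \<theta> Pmax \<nu> i / \<theta> i)) = C"
proof -
  let ?f = "\<lambda>\<nu>. \<Sum>i\<in>I. log 2 (1 + allocation \<theta> Pmax \<nu> i / \<theta> i)"
  \<comment> \<open>The sum of the positive thresholds dominates each of them, so every power is
    saturated at \<open>\<nu> = ?M\<close>, while all powers vanish at
    \<open>\<nu> = 0\<close>.\<close>
  let ?M = "(\<Sum>i\<in>I. \<theta> i) + Pmax"
  have M: "\<theta> i + Pmax \<le> ?M" if "i \<in> I" for i
    using member_le_sum[of i I \<theta>] that assms(1) \<theta> by (simp add: less_imp_le)
  have low: "?f 0 = 0"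
    using \<theta> by (intro sum.neutral) (auto simp: allocation_def)
  have high: "?f ?M = (\<Sum>i\<in>I. log 2 (1 + Pmax / \<theta> i))"
    using M assms(3) by (intro sum.cong) (auto simp: allocation_eq_clamp)
  have cont: "continuous_on {0..?M} ?f"
    unfolding allocation_eq_clamp[OF assms(3)]
  proof (intro continuous_on_sum)
    fix i assume "i \<in> I"
    then have "\<theta> i > 0" by (rule \<theta>)
    then have "1 + max 0 (min Pmax (\<nu> - \<theta> i)) / \<theta> i > 0" for \<nu>
      by (intro add_pos_nonneg) auto
    then show "continuous_on {0..?M} (\<lambda>\<nu>. log 2 (1 + max 0 (min Pmax (\<nu> - \<theta> i)) / \<theta> i))"
      using \<open>\<theta> i > 0\<close> by (intro continuous_intros) (auto simp: less_imp_neq[symmetric])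
  qed
  have "?M \<ge> 0"
    using \<theta> assms(3) by (intro add_nonneg_nonneg sum_nonneg) (auto intro: less_imp_le)
  then have "\<exists>\<nu>\<ge>0. \<nu> \<le> ?M \<and> ?f \<nu> = C"
    using low high max assms(4) by (intro IVT'[OF _ _ _ cont]) auto
  then show ?thesis by blast
qed

section \<open>Characterisation of solutions and multipliers\<close>

lemma rate_theta: "P i * lam i / (1 + sig2 * Pf) = P i / theta lam sig2 Pf i"
  by (simp add: theta_def)

text \<open>The allocation depends on \<open>\<nu>\<close>, and the equation for
  \<open>\<nu>\<close> depends on the allocation through \<open>I1\<close> and \<open>I2\<close>.
  The last conjunct therefore treats both as one system in the pair of \<open>P\<close> and
  \<open>\<nu>\<close>.\<close>

theorem theorem2:
  fixes I :: "'i set" and lam :: "'i \<Rightarrow> real" and sig2 Pf Pmax C :: real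
  assumes "finite I" and "I \<noteq> {}"
    and "\<And>i. i \<in> I \<Longrightarrow> lam i > 0"
    and "sig2 \<ge> 0" and "Pf \<ge> 0" and "Pmax > 0" and "C > 0"
  shows "((\<exists>P. feasible I lam sig2 Pf Pmax C P) \<longleftrightarrow>
            (\<Sum>i\<in>I. log 2 (1 + Pmax / theta lam sig2 Pf i)) \<ge> C) \<and>
         ((\<exists>P. feasible I lam sig2 Pf Pmax C P) \<longrightarrow>
            (\<exists>P. solution I lam sig2 Pf Pmax C P) \<and>
            (\<forall>P Q. solution I lam sig2 Pf Pmax C P \<longrightarrow> solution I lam sig2 Pf Pmax C Q \<longrightarrow>
               (\<forall>i\<in>I. P i = Q i)) \<and>
            (\<forall>P. solution I lam sig2 Pf Pmax C P \<longrightarrow>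
               (\<exists>\<nu>. lagrange_multiplier I lam sig2 Pf Pmax C P \<nu>)) \<and>
            (\<forall>P \<nu>. solution I lam sig2 Pf Pmax C P \<and> lagrange_multiplier I lam sig2 Pf Pmax C P \<nu> \<longleftrightarrow>
               (\<forall>i\<in>I. P i = allocation (theta lam sig2 Pf) Pmax \<nu> i) \<and>
               multiplier_equation I (theta lam sig2 Pf) Pmax C P \<nu>))"
proof -
  let ?\<theta> = "theta lam sig2 Pf"
  let ?rate = "\<lambda>P. \<Sum>i\<in>I. log 2 (1 + P i / ?\<theta> i)"
  let ?alloc = "\<lambda>\<nu> P. \<forall>i\<in>I. P i = allocation ?\<theta> Pmax \<nu> i"
  let ?F = "feasible I lam sig2 Pf Pmax C" and ?S = "solution I lam sig2 Pf Pmax C"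
  let ?L = "lagrange_multiplier I lam sig2 Pf Pmax C"
  have \<theta>: "?\<theta> i > 0" if "i \<in> I" for i
    using assms(3)[OF that] assms(4,5) by (simp add: theta_def add_pos_nonneg)
  have feas: "?F P \<longleftrightarrow> ?rate P \<ge> C \<and> (\<forall>i\<in>I. 0 \<le> P i \<and> P i \<le> Pmax)" for P
    unfolding feasible_def rate_theta ..
  have sol: "?S P \<longleftrightarrow> ?F P \<and> (\<forall>Q. ?F Q \<longrightarrow> sum P I \<le> sum Q I)" for P
    unfolding solution_def is_arg_min_linorder ..
  have lagr: "?L P \<nu> \<longleftrightarrow> \<nu> \<ge> 0 \<and> \<nu> * (?rate P - C) = 0 \<and>
     (\<exists>\<mu>L \<mu>U. \<forall>i\<in>I. \<mu>L i \<ge> 0 \<and> \<mu>U i \<ge> 0 \<and> \<mu>L i * P i = 0 \<and> \<mu>U i * (Pmax - P i) = 0 \<and>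
        1 - \<nu> / (?\<theta> i + P i) - \<mu>L i + \<mu>U i = 0)" for P \<nu>
    unfolding lagrange_multiplier_def rate_theta ..
  have mono: "?rate P \<le> ?rate (\<lambda>_. Pmax)" if "\<forall>i\<in>I. 0 \<le> P i \<and> P i \<le> Pmax" for P
  proof (rule sum_mono)
    fix i assume "i \<in> I"
    with that \<theta>[of i] show "log 2 (1 + P i / ?\<theta> i) \<le> log 2 (1 + Pmax / ?\<theta> i)"
      by (intro log_mono) (auto intro!: add_pos_nonneg divide_right_mono)
  qed
  have feas_iff: "(\<exists>P. ?F P) \<longleftrightarrow> ?rate (\<lambda>_. Pmax) \<ge> C"
  proof
    assume "\<exists>P. ?F P"
    then show "?rate (\<lambda>_. Pmax) \<ge> C" using feas mono order_trans by blast
  next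
    assume "?rate (\<lambda>_. Pmax) \<ge> C"
    then have "?F (\<lambda>_. Pmax)" using feas assms(6) by simp
    then show "\<exists>P. ?F P" by blast
  qed
  have zero: "?rate P = 0" if "\<forall>i\<in>I. P i = 0" for P
    using that by (simp add: sum.neutral)

  \<comment> \<open>Sufficiency: an allocation that meets the rate with equality is optimal, and
    strict minimality also yields uniqueness.\<close>
  have optimal: "?S P \<and> ?L P \<nu> \<and> (\<forall>Q. ?S Q \<longrightarrow> (\<forall>i\<in>I. Q i = P i))"
    if a: "?alloc \<nu> P" and r: "?rate P = C" for P \<nu>
  proof -
    have nu: "\<nu> > 0"
    proof (rule ccontr)
      \<comment> \<open>Below every threshold all powers are zero, so the rate would be 0 instead of
        \<open>C > 0\<close>.\<close>
      assume "\<not> \<nu> > 0"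
      then have "\<forall>i\<in>I. P i = 0"
        using a \<theta> by (force simp: allocation_def)
      then show False using zero[of P] r assms(7) by simp
    qed
    have F: "?F P" using a r assms(6) by (auto simp: feas allocation_eq_clamp)
    have strict: "sum P I < sum Q I" if "?F Q" "j \<in> I" "Q j \<noteq> P j" for Q j
      by (rule allocation_strict_minimum[of I ?\<theta> Pmax \<nu> P Q j])
        (use assms(1,6) \<theta> nu a r that in \<open>auto simp: feas\<close>)
    have "sum P I \<le> sum Q I" if "?F Q" for Q
    proof (cases "\<forall>j\<in>I. Q j = P j")
      case True
      then show ?thesis by simp
    next
      case False
      then show ?thesis using strict[OF that] by (auto intro: less_imp_le)
    qed
    then have S: "?S P" using F sol by blast
    have "\<forall>i\<in>I. \<exists>l u. l \<ge> 0 \<and> u \<ge> 0 \<and> l * P i = 0 \<and> u * (Pmax - P i) = 0 \<and>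
           1 - \<nu> / (?\<theta> i + P i) - l + u = 0"
      using kkt_if_allocation[of ?\<theta> _ Pmax P \<nu>] \<theta> a assms(6) by blast
    then have "?L P \<nu>"
      \<comment> \<open>Choice collects the multipliers found for each index into functions
        \<open>\<mu>L\<close> and \<open>\<mu>U\<close>.\<close>
      unfolding lagr bchoice_iff using nu r by simp
    moreover have "Q i = P i" if "?S Q" "i \<in> I" for Q i
      using strict[of Q i] that sol F by force
    ultimately show ?thesis using S by blast
  qed

  \<comment> \<open>Necessity: stationarity fixes the allocation index by index, and slackness with
    \<open>\<nu> \<noteq> 0\<close> makes the rate constraint active.\<close>
  have stationary: "?alloc \<nu> P \<and> ?rate P = C" if "?S P" "?L P \<nu>" for P \<nu>
  proof -
    have F: "?F P" using that sol by blast
    obtain \<mu>L \<mu>U where \<mu>: "\<forall>i\<in>I. \<mu>L i \<ge> 0 \<and> \<mu>U i \<ge> 0 \<and> \<mu>L i * P i = 0 \<and>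
        \<mu>U i * (Pmax - P i) = 0 \<and> 1 - \<nu> / (?\<theta> i + P i) - \<mu>L i + \<mu>U i = 0"
      using \<open>?L P \<nu>\<close> lagr by blast
    have a: "?alloc \<nu> P"
    proof
      fix i assume i: "i \<in> I"
      show "P i = allocation ?\<theta> Pmax \<nu> i"
        by (rule allocation_if_kkt[of ?\<theta> i Pmax "P i" "\<mu>L i" "\<mu>U i"])
          (use \<mu> F i \<theta> assms(6) in \<open>auto simp: feas\<close>)
    qed
    have "\<nu> \<noteq> 0"
    proof
      assume "\<nu> = 0"
      then have "\<forall>i\<in>I. P i = 0" using a \<theta> by (simp add: allocation_def)
      then show False using zero[of P] F assms(7) by (simp add: feas)
    qed
    then show ?thesis using \<open>?L P \<nu>\<close> a by (auto simp: lagr)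
  qed

  have eqn: "multiplier_equation I ?\<theta> Pmax C P \<nu> \<longleftrightarrow> ?rate P = C" if "?alloc \<nu> P" for P \<nu>
    using multiplier_equation_iff_rate[of I ?\<theta> Pmax P \<nu> C] assms(1,6) \<theta> that by blast

  have "(\<exists>P. ?S P) \<and> (\<forall>P Q. ?S P \<longrightarrow> ?S Q \<longrightarrow> (\<forall>i\<in>I. P i = Q i)) \<and>
      (\<forall>P. ?S P \<longrightarrow> (\<exists>\<nu>. ?L P \<nu>))" if feasible: "\<exists>P. ?F P"
  proof -
    obtain \<nu> where \<nu>: "?rate (allocation ?\<theta> Pmax \<nu>) = C"
      using ex_allocation_with_rate[of I ?\<theta> Pmax C] assms(1,6,7) \<theta> feasible feas_iff by auto
    let ?P = "allocation ?\<theta> Pmax \<nu>"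
    have opt: "?S ?P" "\<And>Q i. ?S Q \<Longrightarrow> i \<in> I \<Longrightarrow> Q i = ?P i"
      using optimal[of ?P \<nu>] \<nu> by blast+
    \<comment> \<open>Uniqueness takes the place of a constraint qualification: every solution
      agrees on \<open>I\<close> with the constructed one and inherits its multiplier.\<close>
    have "?L Q \<nu>" if Q: "?S Q" for Q
    proof -
      have "?alloc \<nu> Q" using opt(2)[OF Q] by blast
      moreover from this have "?rate Q = C" using \<nu> by simp
      ultimately show ?thesis using optimal by blast
    qed
    with opt show ?thesis by metis
  qed
  moreover have "(?S P \<and> ?L P \<nu>) \<longleftrightarrow> (?alloc \<nu> P \<and> multiplier_equation I ?\<theta> Pmax C P \<nu>)" for P \<nu>
    using optimal[of P \<nu>] stationary[of P \<nu>] eqn[of P \<nu>] by argo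
  ultimately show ?thesis using feas_iff by blast
qed

end
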